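(* Let $R$ be a ring and $M$ a right $R$-module. The following statements are equivalent: (i) $M$ is semisimple. (ii) $M$ is co-retractable and Baer. (iii) $M$ is retractable and dual Baer.
   Context: Rings have a unit element and modules are right unitary modules. Let $S=\mathrm{End}_R(M)$. $M$ is Baer if for every non-empty subset $X\subseteq S$ the submodule $\bigcap_{f\in X}\ker f$ is a direct summand of $M$. $M$ is dual Baer if for every submodule $N\leq M$ the right ideal $\mathrm{Hom}_R(M,N)$ of $S$ equals $eS$ for some $e=e^2\in S$. $M$ is retractable if $\mathrm{Hom}_R(M,N)\neq 0$ for every nonzero submodule $N$ of $M$. $M$ is co-retractable if $\mathrm{Hom}_R(M/N,M)\neq 0$ for every proper submodule $N$ of $M$. *)

theory Defs
  imports "HOL-Algebra.AbelCoset"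
begin

section \<open>Right modules over a ring\<close>

text \<open>
  The library's module locale requires a commutative ring of scalars, so right modules over an
  arbitrary ring (HOL-Algebra rings are associative and unital) are introduced here. As in the
  library's record for modules, the record extends that of rings, whose fields for
  multiplication and one are not used.
\<close>

record ('a, 'b) rmodule = "'b ring" +
  rsmult :: "['b, 'a] \<Rightarrow> 'b" (infixl \<open>\<cdot>\<index>\<close> 70)

locale right_module = R?: ring R + M?: abelian_group M
  for R :: "('a, 'r) ring_scheme" (structure) and M :: "('a, 'b, 'm) rmodule_scheme" (structure) +
  assumes rsmult_closed [simp, intro]:
      "\<lbrakk> x \<in> carrier M; a \<in> carrier R \<rbrakk> \<Longrightarrow> x \<cdot>\<^bsub>M\<^esub> a \<in> carrier M"
    and rsmult_add_left:
      "\<lbrakk> x \<in> carrier M; y \<in> carrier M; a \<in> carrier R \<rbrakk> \<Longrightarrow>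
       (x \<oplus>\<^bsub>M\<^esub> y) \<cdot>\<^bsub>M\<^esub> a = x \<cdot>\<^bsub>M\<^esub> a \<oplus>\<^bsub>M\<^esub> y \<cdot>\<^bsub>M\<^esub> a"
    and rsmult_add_right:
      "\<lbrakk> x \<in> carrier M; a \<in> carrier R; b \<in> carrier R \<rbrakk> \<Longrightarrow>
       x \<cdot>\<^bsub>M\<^esub> (a \<oplus>\<^bsub>R\<^esub> b) = x \<cdot>\<^bsub>M\<^esub> a \<oplus>\<^bsub>M\<^esub> x \<cdot>\<^bsub>M\<^esub> b"
    and rsmult_assoc:
      "\<lbrakk> x \<in> carrier M; a \<in> carrier R; b \<in> carrier R \<rbrakk> \<Longrightarrow>
       x \<cdot>\<^bsub>M\<^esub> (a \<otimes>\<^bsub>R\<^esub> b) = (x \<cdot>\<^bsub>M\<^esub> a) \<cdot>\<^bsub>M\<^esub> b"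
    and rsmult_one [simp]:
      "x \<in> carrier M \<Longrightarrow> x \<cdot>\<^bsub>M\<^esub> \<one>\<^bsub>R\<^esub> = x"

locale rsubmodule = additive_subgroup N M
  for N and R :: "('a, 'r) ring_scheme" and M :: "('a, 'b, 'm) rmodule_scheme" (structure) +
  assumes rsmult_mem: "\<lbrakk> x \<in> N; a \<in> carrier R \<rbrakk> \<Longrightarrow> x \<cdot>\<^bsub>M\<^esub> a \<in> N"

text \<open>A submodule \<open>N\<close> of \<open>M\<close>, considered as a module in its own right.\<close>

abbreviation restrict_rmodule ::
  "('a, 'b, 'm) rmodule_scheme \<Rightarrow> 'b set \<Rightarrow> ('a, 'b, 'm) rmodule_scheme"
  where "restrict_rmodule M N \<equiv> M\<lparr>carrier := N\<rparr>"

text \<open>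
  The quotient module: \<open>(N + x) r = N + x r\<close>, written as a union over representatives in the
  same way as the multiplication of the library's quotient ring.
\<close>

definition quot_rmodule ::
  "('a, 'b, 'm) rmodule_scheme \<Rightarrow> 'b set \<Rightarrow> ('a, 'b set) rmodule"
  where "quot_rmodule M N =
    \<lparr>carrier = a_rcosets\<^bsub>M\<^esub> N, mult = (\<lambda>_ _. undefined), one = undefined,
     zero = N, add = set_add M, rsmult = (\<lambda>X a. \<Union>x\<in>X. N +>\<^bsub>M\<^esub> (x \<cdot>\<^bsub>M\<^esub> a))\<rparr>"

lemma (in right_module) quot_rsmult:
  assumes "rsubmodule N R M" "x \<in> carrier M" "a \<in> carrier R"
  shows "(N +>\<^bsub>M\<^esub> x) \<cdot>\<^bsub>quot_rmodule M N\<^esub> a = N +>\<^bsub>M\<^esub> (x \<cdot>\<^bsub>M\<^esub> a)"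
proof -
  interpret N: rsubmodule N R M by fact
  interpret ab: abelian_subgroup N M
    by (rule abelian_subgroupI3[OF N.additive_subgroup_axioms M.abelian_group_axioms])
  have eq: "N +>\<^bsub>M\<^esub> (y \<cdot>\<^bsub>M\<^esub> a) = N +>\<^bsub>M\<^esub> (x \<cdot>\<^bsub>M\<^esub> a)" if y: "y \<in> N +>\<^bsub>M\<^esub> x" for y
  proof -
    obtain n where n: "n \<in> N" "y = n \<oplus>\<^bsub>M\<^esub> x" using y by (auto simp: a_r_coset_def')
    have "y \<cdot>\<^bsub>M\<^esub> a = n \<cdot>\<^bsub>M\<^esub> a \<oplus>\<^bsub>M\<^esub> x \<cdot>\<^bsub>M\<^esub> a"
      using n assms N.a_subset by (auto simp: rsmult_add_left)
    then have "y \<cdot>\<^bsub>M\<^esub> a \<in> N +>\<^bsub>M\<^esub> (x \<cdot>\<^bsub>M\<^esub> a)"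
      using N.rsmult_mem[OF n(1) assms(3)] by (auto simp: a_r_coset_def')
    then show ?thesis
      using M.a_repr_independence[OF _ rsmult_closed[OF assms(2,3)] N.a_subgroup] by simp
  qed
  have "(\<Union>y\<in>N +>\<^bsub>M\<^esub> x. N +>\<^bsub>M\<^esub> (y \<cdot>\<^bsub>M\<^esub> a)) = (\<Union>y\<in>N +>\<^bsub>M\<^esub> x. N +>\<^bsub>M\<^esub> (x \<cdot>\<^bsub>M\<^esub> a))"
    by (rule SUP_cong[OF refl]) (rule eq)
  moreover have "N +>\<^bsub>M\<^esub> x \<noteq> {}" using ab.a_rcos_self[OF assms(2)] by blast
  ultimately show ?thesis by (simp add: quot_rmodule_def)
qed

lemma (in right_module) quot_right_module:
  assumes "rsubmodule N R M"
  shows "right_module R (quot_rmodule M N)"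
proof -
  interpret N: rsubmodule N R M by fact
  interpret ab: abelian_subgroup N M
    by (rule abelian_subgroupI3[OF N.additive_subgroup_axioms M.abelian_group_axioms])
  let ?Q = "quot_rmodule M N"
  have Qc: "carrier ?Q = (\<lambda>x. N +>\<^bsub>M\<^esub> x) ` carrier M"
    by (auto simp: quot_rmodule_def A_RCOSETS_def' )
  have Qa: "(N +>\<^bsub>M\<^esub> x) \<oplus>\<^bsub>?Q\<^esub> (N +>\<^bsub>M\<^esub> y) = N +>\<^bsub>M\<^esub> (x \<oplus>\<^bsub>M\<^esub> y)"
    if "x \<in> carrier M" "y \<in> carrier M" for x y
    using that by (simp add: quot_rmodule_def ab.a_rcos_sum)
  have Q0: "\<zero>\<^bsub>?Q\<^esub> = N +>\<^bsub>M\<^esub> \<zero>\<^bsub>M\<^esub>"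
    using N.a_subset by (simp add: quot_rmodule_def)
  have Qs: "(N +>\<^bsub>M\<^esub> x) \<cdot>\<^bsub>?Q\<^esub> a = N +>\<^bsub>M\<^esub> (x \<cdot>\<^bsub>M\<^esub> a)" if "x \<in> carrier M" "a \<in> carrier R" for x a
    using quot_rsmult[OF assms that] .
  have inv: "\<exists>z\<in>carrier M. N +>\<^bsub>M\<^esub> (z \<oplus>\<^bsub>M\<^esub> x) = N +>\<^bsub>M\<^esub> \<zero>\<^bsub>M\<^esub>" if "x \<in> carrier M" for x
    using that by (intro bexI[of _ "\<ominus>\<^bsub>M\<^esub> x"]) (auto simp: M.l_neg)
  have "abelian_group ?Q"
  proof (rule abelian_groupI, goal_cases)
    case (6 X)
    then show ?case using inv by (auto simp: Qc Qa Q0)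
  next
    case (3 X Y Z)
    then show ?case by (auto simp: Qc Qa M.a_assoc)
  next
    case (4 X Y)
    then show ?case by (auto simp: Qc Qa M.a_comm)
  qed (auto simp: Qc Qa Q0)
  then show ?thesis
    by (intro right_module.intro R.ring_axioms right_module_axioms.intro)
      (auto simp: Qc Qa Qs rsmult_add_left rsmult_add_right rsmult_assoc)
qed

section \<open>Homomorphisms and the endomorphism ring\<close>

text \<open>
  Homomorphisms are extensional functions (\<open>undefined\<close> outside the carrier), so that equality
  of homomorphisms is equality on the carrier. In particular \<open>Hom(M, N)\<close> for a submodule \<open>N\<close>
  of \<open>M\<close> is literally a subset of \<open>End(M)\<close>.
\<close>

definition rmod_hom ::
  "('a, 'r) ring_scheme \<Rightarrow> ('a, 'b, 'm) rmodule_scheme \<Rightarrow> ('a, 'c, 'n) rmodule_scheme \<Rightarrow> ('b \<Rightarrow> 'c) set"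
  where "rmod_hom R M N = {f \<in> carrier M \<rightarrow>\<^sub>E carrier N.
    (\<forall>x\<in>carrier M. \<forall>y\<in>carrier M. f (x \<oplus>\<^bsub>M\<^esub> y) = f x \<oplus>\<^bsub>N\<^esub> f y) \<and>
    (\<forall>x\<in>carrier M. \<forall>a\<in>carrier R. f (x \<cdot>\<^bsub>M\<^esub> a) = f x \<cdot>\<^bsub>N\<^esub> a)}"

definition zero_hom ::
  "('a, 'b, 'm) rmodule_scheme \<Rightarrow> ('a, 'c, 'n) rmodule_scheme \<Rightarrow> 'b \<Rightarrow> 'c"
  where "zero_hom M N = (\<lambda>x\<in>carrier M. \<zero>\<^bsub>N\<^esub>)"

definition End_ring ::
  "('a, 'r) ring_scheme \<Rightarrow> ('a, 'b, 'm) rmodule_scheme \<Rightarrow> ('b \<Rightarrow> 'b) ring"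
  where "End_ring R M =
    \<lparr>carrier = rmod_hom R M M, mult = compose (carrier M), one = (\<lambda>x\<in>carrier M. x),
     zero = zero_hom M M, add = (\<lambda>f g. \<lambda>x\<in>carrier M. f x \<oplus>\<^bsub>M\<^esub> g x)\<rparr>"

lemma (in right_module) zero_rsmult:
  assumes "a \<in> carrier R" shows "\<zero>\<^bsub>M\<^esub> \<cdot>\<^bsub>M\<^esub> a = \<zero>\<^bsub>M\<^esub>"
proof -
  have "\<zero>\<^bsub>M\<^esub> \<cdot>\<^bsub>M\<^esub> a \<oplus>\<^bsub>M\<^esub> \<zero>\<^bsub>M\<^esub> \<cdot>\<^bsub>M\<^esub> a = \<zero>\<^bsub>M\<^esub> \<cdot>\<^bsub>M\<^esub> a"
    using rsmult_add_left[of "\<zero>\<^bsub>M\<^esub>" "\<zero>\<^bsub>M\<^esub>" a] assms by simp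
  then show ?thesis using assms by simp
qed

lemma (in right_module) neg_rsmult:
  assumes "x \<in> carrier M" "a \<in> carrier R"
  shows "(\<ominus>\<^bsub>M\<^esub> x) \<cdot>\<^bsub>M\<^esub> a = \<ominus>\<^bsub>M\<^esub> (x \<cdot>\<^bsub>M\<^esub> a)"
proof -
  have "(\<ominus>\<^bsub>M\<^esub> x) \<cdot>\<^bsub>M\<^esub> a \<oplus>\<^bsub>M\<^esub> x \<cdot>\<^bsub>M\<^esub> a = \<zero>\<^bsub>M\<^esub>"
    using rsmult_add_left[of "\<ominus>\<^bsub>M\<^esub> x" x a] assms by (simp add: M.l_neg zero_rsmult)
  then show ?thesis using assms by (simp add: M.minus_equality)
qed

lemma (in right_module) ring_End_ring: "ring (End_ring R M)"
proof -
  let ?S = "End_ring R M" and ?H = "rmod_hom R M M"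
  have mem: "f x \<in> carrier M" if "f \<in> ?H" "x \<in> carrier M" for f x
    using that by (auto simp: rmod_hom_def)
  have ext: "f = g"
    if "f \<in> extensional (carrier M)" "g \<in> extensional (carrier M)"
      "\<And>x. x \<in> carrier M \<Longrightarrow> f x = g x" for f g :: "'b \<Rightarrow> 'b"
    using that by (rule extensionalityI)
  have e: "f \<in> extensional (carrier M)" if "f \<in> ?H" for f
    using that by (auto simp: rmod_hom_def PiE_def)
  have add: "f (x \<oplus>\<^bsub>M\<^esub> y) = f x \<oplus>\<^bsub>M\<^esub> f y" if "f \<in> ?H" "x \<in> carrier M" "y \<in> carrier M" for f x y
    using that by (auto simp: rmod_hom_def)
  have scal: "f (x \<cdot>\<^bsub>M\<^esub> a) = f x \<cdot>\<^bsub>M\<^esub> a" if "f \<in> ?H" "x \<in> carrier M" "a \<in> carrier R" for f x a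
    using that by (auto simp: rmod_hom_def)
  have homI: "(\<lambda>x\<in>carrier M. h x) \<in> ?H"
    if "\<And>x. x \<in> carrier M \<Longrightarrow> h x \<in> carrier M"
      "\<And>x y. \<lbrakk>x \<in> carrier M; y \<in> carrier M\<rbrakk> \<Longrightarrow> h (x \<oplus>\<^bsub>M\<^esub> y) = h x \<oplus>\<^bsub>M\<^esub> h y"
      "\<And>x a. \<lbrakk>x \<in> carrier M; a \<in> carrier R\<rbrakk> \<Longrightarrow> h (x \<cdot>\<^bsub>M\<^esub> a) = h x \<cdot>\<^bsub>M\<^esub> a" for h
    using that by (simp add: rmod_hom_def)
  have c0: "zero_hom M M \<in> ?H"
    unfolding zero_hom_def by (rule homI) (simp_all add: zero_rsmult)
  have c1: "(\<lambda>x\<in>carrier M. x) \<in> ?H"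
    by (rule homI) simp_all
  have ca: "(\<lambda>x\<in>carrier M. f x \<oplus>\<^bsub>M\<^esub> g x) \<in> ?H" if "f \<in> ?H" "g \<in> ?H" for f g
    by (rule homI) (simp_all add: that mem add scal rsmult_add_left M.add.m_ac)
  have cn: "(\<lambda>x\<in>carrier M. \<ominus>\<^bsub>M\<^esub> f x) \<in> ?H" if "f \<in> ?H" for f
    by (rule homI) (simp_all add: that mem add scal neg_rsmult M.minus_add)
  have cc: "compose (carrier M) f g \<in> ?H" if "f \<in> ?H" "g \<in> ?H" for f g
    unfolding compose_def by (rule homI) (simp_all add: that mem add scal)
  have "abelian_group ?S"
  proof (rule abelian_groupI, goal_cases)
    case (3 f g h)
    then show ?case by (intro ext) (simp_all add: End_ring_def mem M.a_assoc)
  next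
    case (4 f g)
    then show ?case by (intro ext) (simp_all add: End_ring_def mem M.a_comm)
  next
    case (5 f)
    then show ?case by (intro ext) (simp_all add: End_ring_def mem e zero_hom_def)
  next
    case (6 f)
    then have f: "f \<in> ?H" by (simp add: End_ring_def)
    have "(\<lambda>x\<in>carrier M. \<ominus>\<^bsub>M\<^esub> f x) \<oplus>\<^bsub>?S\<^esub> f = \<zero>\<^bsub>?S\<^esub>"
      by (rule ext) (simp_all add: End_ring_def zero_hom_def mem f M.l_neg)
    moreover have "(\<lambda>x\<in>carrier M. \<ominus>\<^bsub>M\<^esub> f x) \<in> carrier ?S"
      using cn[OF f] by (simp add: End_ring_def)
    ultimately show ?case by blast
  qed (simp_all add: End_ring_def c0 ca)
  moreover have "monoid ?S"
  proof (rule monoidI, goal_cases)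
    case (3 f g h)
    then show ?case by (intro ext) (simp_all add: End_ring_def mem compose_def)
  next
    case (4 f)
    then show ?case by (intro ext) (simp_all add: End_ring_def mem e compose_def)
  next
    case (5 f)
    then show ?case by (intro ext) (simp_all add: End_ring_def mem e compose_def)
  qed (simp_all add: End_ring_def c1 cc)
  moreover have "h \<otimes>\<^bsub>?S\<^esub> (f \<oplus>\<^bsub>?S\<^esub> g) = h \<otimes>\<^bsub>?S\<^esub> f \<oplus>\<^bsub>?S\<^esub> h \<otimes>\<^bsub>?S\<^esub> g"
    "(f \<oplus>\<^bsub>?S\<^esub> g) \<otimes>\<^bsub>?S\<^esub> h = f \<otimes>\<^bsub>?S\<^esub> h \<oplus>\<^bsub>?S\<^esub> g \<otimes>\<^bsub>?S\<^esub> h"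
    if "f \<in> carrier ?S" "g \<in> carrier ?S" "h \<in> carrier ?S" for f g h
    using that by (intro ext; simp add: End_ring_def compose_def add mem)+
  ultimately show ?thesis
    by (intro ringI)
qed

section \<open>Direct sums and semisimple modules\<close>

definition direct_summand ::
  "('a, 'r) ring_scheme \<Rightarrow> ('a, 'b, 'm) rmodule_scheme \<Rightarrow> 'b set \<Rightarrow> bool"
  where "direct_summand R M N \<longleftrightarrow> rsubmodule N R M \<and>
    (\<exists>K. rsubmodule K R M \<and> N \<inter> K = {\<zero>\<^bsub>M\<^esub>} \<and> N <+>\<^bsub>M\<^esub> K = carrier M)"

text \<open>The submodule generated by the union of a family, i.e. its sum for a family of submodules.\<close>

definition rmod_sum ::
  "('a, 'r) ring_scheme \<Rightarrow> ('a, 'b, 'm) rmodule_scheme \<Rightarrow> 'b set set \<Rightarrow> 'b set"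
  where "rmod_sum R M F = \<Inter>{N. rsubmodule N R M \<and> \<Union>F \<subseteq> N}"

text \<open>The module is the internal direct sum of the given set of submodules.\<close>

definition is_direct_sum ::
  "('a, 'r) ring_scheme \<Rightarrow> ('a, 'b, 'm) rmodule_scheme \<Rightarrow> 'b set set \<Rightarrow> bool"
  where "is_direct_sum R M F \<longleftrightarrow> (\<forall>N\<in>F. rsubmodule N R M) \<and> rmod_sum R M F = carrier M \<and>
    (\<forall>N\<in>F. N \<inter> rmod_sum R M (F - {N}) = {\<zero>\<^bsub>M\<^esub>})"

definition simple_rmodule ::
  "('a, 'r) ring_scheme \<Rightarrow> ('a, 'b, 'm) rmodule_scheme \<Rightarrow> bool"
  where "simple_rmodule R M \<longleftrightarrow> carrier M \<noteq> {\<zero>\<^bsub>M\<^esub>} \<and>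
    (\<forall>N. rsubmodule N R M \<longrightarrow> N = {\<zero>\<^bsub>M\<^esub>} \<or> N = carrier M)"

text \<open>
  Sets of submodules suffice here instead of indexed families: nonzero submodules whose sum is
  direct are pairwise distinct. The zero module is semisimple (empty direct sum).
\<close>

definition semisimple_rmodule ::
  "('a, 'r) ring_scheme \<Rightarrow> ('a, 'b, 'm) rmodule_scheme \<Rightarrow> bool"
  where "semisimple_rmodule R M \<longleftrightarrow>
    (\<exists>F. is_direct_sum R M F \<and> (\<forall>N\<in>F. simple_rmodule R (restrict_rmodule M N)))"

section \<open>Baer, dual Baer, retractable and co-retractable modules\<close>

definition Baer ::
  "('a, 'r) ring_scheme \<Rightarrow> ('a, 'b, 'm) rmodule_scheme \<Rightarrow> bool"
  where "Baer R M \<longleftrightarrow>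
    (\<forall>X \<subseteq> carrier (End_ring R M). X \<noteq> {} \<longrightarrow> direct_summand R M (\<Inter>f\<in>X. a_kernel M M f))"

text \<open>In the following, \<open>e <#\<^bsub>S\<^esub> carrier S\<close> is the right ideal \<open>eS\<close>.\<close>

definition dual_Baer ::
  "('a, 'r) ring_scheme \<Rightarrow> ('a, 'b, 'm) rmodule_scheme \<Rightarrow> bool"
  where "dual_Baer R M \<longleftrightarrow> (let S = End_ring R M in
    \<forall>N. rsubmodule N R M \<longrightarrow>
      (\<exists>e\<in>carrier S. e \<otimes>\<^bsub>S\<^esub> e = e \<and> rmod_hom R M (restrict_rmodule M N) = e <#\<^bsub>S\<^esub> carrier S))"

definition retractable ::
  "('a, 'r) ring_scheme \<Rightarrow> ('a, 'b, 'm) rmodule_scheme \<Rightarrow> bool"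
  where "retractable R M \<longleftrightarrow>
    (\<forall>N. rsubmodule N R M \<and> N \<noteq> {\<zero>\<^bsub>M\<^esub>} \<longrightarrow>
      rmod_hom R M (restrict_rmodule M N) \<noteq> {zero_hom M (restrict_rmodule M N)})"

definition co_retractable ::
  "('a, 'r) ring_scheme \<Rightarrow> ('a, 'b, 'm) rmodule_scheme \<Rightarrow> bool"
  where "co_retractable R M \<longleftrightarrow>
    (\<forall>N. rsubmodule N R M \<and> N \<noteq> carrier M \<longrightarrow>
      rmod_hom R (quot_rmodule M N) M \<noteq> {zero_hom (quot_rmodule M N) M})"

end

theory Submission
  imports Defs
begin

text \<open>
  A module is semisimple iff each of its submodules is a direct summand, and the latter is what is
  compared with (ii) and (iii). If all submodules split, projections give all four properties.

  Conversely, let \<open>M\<close> be co-retractable and Baer, \<open>N \<le> M\<close>, and let \<open>I \<supseteq> N\<close> be the common kernel of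
  all endomorphisms that vanish on \<open>N\<close>. Then \<open>M = I \<oplus> K\<close>, and a nonzero map \<open>M / (N + K) \<rightarrow> M\<close> would
  vanish on \<open>I\<close> and on \<open>K\<close>; so \<open>N + K = M\<close> and \<open>N = I\<close>.

  Let \<open>M\<close> be retractable and dual Baer and \<open>Hom(M, N) = eS\<close>. A nonzero map \<open>f\<close> from \<open>M\<close> to
  \<open>N \<inter> (1 - e)M\<close> would satisfy \<open>f = e f = 0\<close>; so \<open>N \<inter> (1 - e)M = 0\<close> and \<open>M = N \<oplus> (1 - e)M\<close>.
\<close>

section \<open>Submodules\<close>

lemma rsubmodule_subset: "rsubmodule N R M \<Longrightarrow> N \<subseteq> carrier M"
  using additive_subgroup.a_subset rsubmodule_def by blast

context right_module
begin

text \<open>Closure under negation follows from closure under scalars: the negative of x is x times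
  the negative of the unit of R.\<close>

lemma rsubmodule_iff:
  "rsubmodule N R M \<longleftrightarrow> N \<subseteq> carrier M \<and> \<zero>\<^bsub>M\<^esub> \<in> N \<and> (\<forall>x\<in>N. \<forall>y\<in>N. x \<oplus>\<^bsub>M\<^esub> y \<in> N) \<and>
     (\<forall>x\<in>N. \<forall>a\<in>carrier R. x \<cdot>\<^bsub>M\<^esub> a \<in> N)" (is "_ \<longleftrightarrow> ?r")
proof
  assume "rsubmodule N R M"
  then interpret rsubmodule N R M .
  show ?r using a_subset by (auto intro: a_closed rsmult_mem)
next
  assume r: ?r
  have minus: "\<ominus>\<^bsub>M\<^esub> x \<in> N" if "x \<in> N" for x
  proof -
    have x: "x \<in> carrier M" using r that by blast
    have "x \<cdot>\<^bsub>M\<^esub> (\<ominus>\<^bsub>R\<^esub> \<one>\<^bsub>R\<^esub>) \<oplus>\<^bsub>M\<^esub> x = \<zero>\<^bsub>M\<^esub>"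
    proof -
      have zero: "x \<cdot>\<^bsub>M\<^esub> \<zero>\<^bsub>R\<^esub> = \<zero>\<^bsub>M\<^esub>"
        using rsmult_add_right[OF x R.zero_closed R.zero_closed] x by simp
      show ?thesis
        using rsmult_add_right[OF x, of "\<ominus>\<^bsub>R\<^esub> \<one>\<^bsub>R\<^esub>" "\<one>\<^bsub>R\<^esub>"] x by (simp add: R.l_neg zero)
    qed
    then have "\<ominus>\<^bsub>M\<^esub> x = x \<cdot>\<^bsub>M\<^esub> (\<ominus>\<^bsub>R\<^esub> \<one>\<^bsub>R\<^esub>)" using x by (simp add: M.minus_equality)
    then show ?thesis using r that by simp
  qed
  have "subgroup N (add_monoid M)"
    using r minus by (intro M.add.subgroupI) (auto simp flip: a_inv_def)
  then show "rsubmodule N R M"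
    using r by (simp add: rsubmodule_def rsubmodule_axioms_def additive_subgroup_def)
qed

lemma rsubmodule_minus:
  assumes "rsubmodule N R M" "x \<in> N" shows "\<ominus>\<^bsub>M\<^esub> x \<in> N"
proof -
  interpret rsubmodule N R M by fact
  show ?thesis using a_inv_closed assms M.abelian_group_axioms by blast
qed

lemma rsubmodule_diff:
  assumes "rsubmodule N R M" "x \<in> N" "y \<in> N" shows "x \<ominus>\<^bsub>M\<^esub> y \<in> N"
  using assms rsubmodule_minus rsubmodule_iff by (simp add: a_minus_def)

lemma rsubmodule_zero_mem: "rsubmodule N R M \<Longrightarrow> \<zero>\<^bsub>M\<^esub> \<in> N"
  by (simp add: rsubmodule_iff)

text \<open>Makes \<open>rsubmodule_iff\<close> available for N itself, so that the submodules of N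
  can be compared with those of M.\<close>

lemma right_module_restrict:
  assumes N: "rsubmodule N R M" shows "right_module R (restrict_rmodule M N)"
proof -
  have s: "x \<in> carrier M" if "x \<in> N" for x using N that rsubmodule_subset by blast
  have "abelian_group (restrict_rmodule M N)"
  proof (rule abelian_groupI, goal_cases)
    case (6 x)
    then show ?case
      using rsubmodule_minus[OF N] s by (auto intro!: bexI[of _ "\<ominus>\<^bsub>M\<^esub> x"] simp: M.l_neg)
  qed (use N s in \<open>auto simp: rsubmodule_iff M.a_ac\<close>)
  then show ?thesis
    by (intro right_module.intro R.ring_axioms right_module_axioms.intro)
      (use N s in \<open>auto simp: rsubmodule_iff rsmult_add_left rsmult_add_right rsmult_assoc\<close>)
qed

lemma rsubmodule_restrict_iff:
  assumes N: "rsubmodule N R M"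
  shows "rsubmodule A R (restrict_rmodule M N) \<longleftrightarrow> rsubmodule A R M \<and> A \<subseteq> N"
  using rsubmodule_subset[OF N]
  by (auto simp: rsubmodule_iff right_module.rsubmodule_iff[OF right_module_restrict[OF N]])

text \<open>Lets arguments about simple submodules stay in the lattice of submodules of M.\<close>

lemma simple_restrict_iff:
  assumes "rsubmodule N R M"
  shows "simple_rmodule R (restrict_rmodule M N) \<longleftrightarrow>
    N \<noteq> {\<zero>\<^bsub>M\<^esub>} \<and> (\<forall>A. rsubmodule A R M \<and> A \<subseteq> N \<longrightarrow> A = {\<zero>\<^bsub>M\<^esub>} \<or> A = N)"
  by (simp add: simple_rmodule_def rsubmodule_restrict_iff[OF assms])

lemma rsubmodule_carrier: "rsubmodule (carrier M) R M"
  by (simp add: rsubmodule_iff)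

lemma rsubmodule_zero: "rsubmodule {\<zero>\<^bsub>M\<^esub>} R M"
  by (simp add: rsubmodule_iff zero_rsmult)

lemma rsubmodule_Int:
  "rsubmodule N R M \<Longrightarrow> rsubmodule K R M \<Longrightarrow> rsubmodule (N \<inter> K) R M"
  by (auto simp: rsubmodule_iff)

lemma rsubmodule_Inter:
  "F \<noteq> {} \<Longrightarrow> (\<And>N. N \<in> F \<Longrightarrow> rsubmodule N R M) \<Longrightarrow> rsubmodule (\<Inter>F) R M"
  unfolding rsubmodule_iff by blast

lemma rsubmodule_Union_chain:
  assumes "F \<noteq> {}" and F: "\<And>N. N \<in> F \<Longrightarrow> rsubmodule N R M"
    and chain: "\<And>N K. N \<in> F \<Longrightarrow> K \<in> F \<Longrightarrow> N \<subseteq> K \<or> K \<subseteq> N"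
  shows "rsubmodule (\<Union>F) R M"
proof -
  have "x \<oplus>\<^bsub>M\<^esub> y \<in> \<Union>F" if xy: "x \<in> N" "N \<in> F" "y \<in> K" "K \<in> F" for x y N K
  proof -
    \<comment> \<open>Of two comparable submodules the larger one contains both x and y.\<close>
    obtain L where "L \<in> F" "x \<in> L" "y \<in> L" using chain[OF xy(2,4)] xy by blast
    then show ?thesis using F[of L] by (auto simp: rsubmodule_iff)
  qed
  moreover have "x \<cdot>\<^bsub>M\<^esub> a \<in> \<Union>F" if "x \<in> N" "N \<in> F" "a \<in> carrier R" for x a N
    using F[of N] that unfolding rsubmodule_iff by (intro UnionI[of N]) simp_all
  moreover have "\<zero>\<^bsub>M\<^esub> \<in> \<Union>F" using assms(1) F rsubmodule_zero_mem by blast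
  moreover have "\<Union>F \<subseteq> carrier M" using F rsubmodule_subset by blast
  ultimately show ?thesis unfolding rsubmodule_iff by blast
qed

section \<open>Sums of two submodules\<close>

lemma mem_set_add: "x \<in> N <+>\<^bsub>M\<^esub> K \<longleftrightarrow> (\<exists>n\<in>N. \<exists>k\<in>K. x = n \<oplus>\<^bsub>M\<^esub> k)"
  by (auto simp: set_add_def')

lemma rsubmodule_set_add:
  assumes N: "rsubmodule N R M" and K: "rsubmodule K R M"
  shows "rsubmodule (N <+>\<^bsub>M\<^esub> K) R M" "N \<subseteq> N <+>\<^bsub>M\<^esub> K" "K \<subseteq> N <+>\<^bsub>M\<^esub> K"
proof -
  have s: "N \<subseteq> carrier M" "K \<subseteq> carrier M" using N K rsubmodule_subset by auto
  have z: "\<zero>\<^bsub>M\<^esub> \<in> N" "\<zero>\<^bsub>M\<^esub> \<in> K" using N K by (auto simp: rsubmodule_iff)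
  show l: "N \<subseteq> N <+>\<^bsub>M\<^esub> K"
  proof
    fix x assume "x \<in> N"
    then show "x \<in> N <+>\<^bsub>M\<^esub> K" unfolding mem_set_add using z s by (metis M.r_zero subsetD)
  qed
  show "K \<subseteq> N <+>\<^bsub>M\<^esub> K"
  proof
    fix x assume "x \<in> K"
    then show "x \<in> N <+>\<^bsub>M\<^esub> K" unfolding mem_set_add using z s by (metis M.l_zero subsetD)
  qed
  have add: "x \<oplus>\<^bsub>M\<^esub> y \<in> N <+>\<^bsub>M\<^esub> K" if xy: "x \<in> N <+>\<^bsub>M\<^esub> K" "y \<in> N <+>\<^bsub>M\<^esub> K" for x y
  proof -
    obtain n k n' k' where *: "n \<in> N" "k \<in> K" "x = n \<oplus>\<^bsub>M\<^esub> k" "n' \<in> N" "k' \<in> K" "y = n' \<oplus>\<^bsub>M\<^esub> k'"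
      using xy unfolding mem_set_add by blast
    then have c: "n \<in> carrier M" "k \<in> carrier M" "n' \<in> carrier M" "k' \<in> carrier M" using s by auto
    have "x \<oplus>\<^bsub>M\<^esub> y = (n \<oplus>\<^bsub>M\<^esub> n') \<oplus>\<^bsub>M\<^esub> (k \<oplus>\<^bsub>M\<^esub> k')" using * c by (simp add: M.a_ac)
    moreover have "n \<oplus>\<^bsub>M\<^esub> n' \<in> N" "k \<oplus>\<^bsub>M\<^esub> k' \<in> K" using * N K by (auto simp: rsubmodule_iff)
    ultimately show ?thesis unfolding mem_set_add by blast
  qed
  have smult: "x \<cdot>\<^bsub>M\<^esub> a \<in> N <+>\<^bsub>M\<^esub> K" if x: "x \<in> N <+>\<^bsub>M\<^esub> K" and a: "a \<in> carrier R" for x a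
  proof -
    obtain n k where *: "n \<in> N" "k \<in> K" "x = n \<oplus>\<^bsub>M\<^esub> k" using x unfolding mem_set_add by blast
    then have "x \<cdot>\<^bsub>M\<^esub> a = n \<cdot>\<^bsub>M\<^esub> a \<oplus>\<^bsub>M\<^esub> k \<cdot>\<^bsub>M\<^esub> a" using s a by (auto intro: rsmult_add_left)
    moreover have "n \<cdot>\<^bsub>M\<^esub> a \<in> N" "k \<cdot>\<^bsub>M\<^esub> a \<in> K" using * a N K by (auto simp: rsubmodule_iff)
    ultimately show ?thesis unfolding mem_set_add by blast
  qed
  have "N <+>\<^bsub>M\<^esub> K \<subseteq> carrier M" using s by (fastforce simp: mem_set_add)
  then show "rsubmodule (N <+>\<^bsub>M\<^esub> K) R M" unfolding rsubmodule_iff using add smult l z by blast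
qed

lemma set_add_commute:
  assumes "N \<subseteq> carrier M" "K \<subseteq> carrier M"
  shows "N <+>\<^bsub>M\<^esub> K = K <+>\<^bsub>M\<^esub> N"
proof -
  have "A <+>\<^bsub>M\<^esub> B \<subseteq> B <+>\<^bsub>M\<^esub> A" if "A \<subseteq> carrier M" "B \<subseteq> carrier M" for A B
    using that unfolding mem_set_add subset_iff by (metis M.a_comm)
  then show ?thesis using assms by blast
qed

lemma set_add_subset:
  assumes "rsubmodule L R M" "N \<subseteq> L" "K \<subseteq> L" shows "N <+>\<^bsub>M\<^esub> K \<subseteq> L"
  using assms unfolding mem_set_add rsubmodule_iff subset_iff by blast

lemma eq_of_add_eq:
  assumes "x \<in> carrier M" "y \<in> carrier M" "z \<in> carrier M" "x \<oplus>\<^bsub>M\<^esub> y = z"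
  shows "y = z \<ominus>\<^bsub>M\<^esub> x"
proof -
  have "z \<ominus>\<^bsub>M\<^esub> x = x \<oplus>\<^bsub>M\<^esub> (\<ominus>\<^bsub>M\<^esub> x \<oplus>\<^bsub>M\<^esub> y)"
    using assms(1-3) unfolding assms(4)[symmetric] by (simp add: a_minus_def M.a_ac)
  then show ?thesis using assms(1,2) by (simp add: M.r_neg2)
qed

text \<open>The element n - n' = k' - k lies in both N and K, hence is zero.\<close>

lemma direct_sum_cancel:
  assumes N: "rsubmodule N R M" and K: "rsubmodule K R M" and "N \<inter> K = {\<zero>\<^bsub>M\<^esub>}"
    and "n \<in> N" "n' \<in> N" "k \<in> K" "k' \<in> K" "n \<oplus>\<^bsub>M\<^esub> k = n' \<oplus>\<^bsub>M\<^esub> k'"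
  shows "n = n'" "k = k'"
proof -
  have c: "n \<in> carrier M" "k \<in> carrier M" "n' \<in> carrier M" "k' \<in> carrier M"
    using assms rsubmodule_subset by blast+
  have "n \<ominus>\<^bsub>M\<^esub> n' = k' \<ominus>\<^bsub>M\<^esub> k"
  proof -
    have "k \<oplus>\<^bsub>M\<^esub> (n \<ominus>\<^bsub>M\<^esub> n') = \<ominus>\<^bsub>M\<^esub> n' \<oplus>\<^bsub>M\<^esub> (n \<oplus>\<^bsub>M\<^esub> k)" using c by (simp add: a_minus_def M.a_ac)
    also have "\<dots> = k'" unfolding assms(8) using c by (simp add: M.r_neg1)
    finally show ?thesis using c by (intro eq_of_add_eq) auto
  qed
  then have "n \<ominus>\<^bsub>M\<^esub> n' \<in> N \<inter> K"
    using rsubmodule_diff[OF N assms(4,5)] rsubmodule_diff[OF K assms(7,6)] by (metis IntI)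
  then have "n \<ominus>\<^bsub>M\<^esub> n' = \<zero>\<^bsub>M\<^esub>" using assms(3) by blast
  moreover have "(n \<ominus>\<^bsub>M\<^esub> n') \<oplus>\<^bsub>M\<^esub> n' = n" using c by (simp add: a_minus_def M.a_assoc M.l_neg)
  ultimately show "n = n'" using c by simp
  then show "k = k'" using assms(8) c by simp
qed

text \<open>The component of x in N also lies in L; subtracting it shows that the component in K
  lies in L.\<close>

lemma modular_law:
  assumes N: "rsubmodule N R M" and K: "rsubmodule K R M" and L: "rsubmodule L R M" and "N \<subseteq> L"
    and "x \<in> L" "x \<in> N <+>\<^bsub>M\<^esub> K"
  shows "x \<in> N <+>\<^bsub>M\<^esub> (K \<inter> L)"
proof -
  obtain n k where nk: "n \<in> N" "k \<in> K" "x = n \<oplus>\<^bsub>M\<^esub> k" using assms unfolding mem_set_add by blast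
  then have "k = x \<ominus>\<^bsub>M\<^esub> n"
    using eq_of_add_eq[of n k x] assms rsubmodule_subset by blast
  then have "k \<in> L" using rsubmodule_diff[OF L] nk assms by blast
  then show ?thesis using nk unfolding mem_set_add by blast
qed

section \<open>Sums of families of submodules\<close>

lemma rsubmodule_rmod_sum:
  assumes "\<And>N. N \<in> F \<Longrightarrow> rsubmodule N R M"
  shows "rsubmodule (rmod_sum R M F) R M"
proof -
  \<comment> \<open>The intersection of an empty family would be the whole type; the carrier shows
    that the family in \<open>rmod_sum\<close> is nonempty.\<close>
  have "carrier M \<in> {N. rsubmodule N R M \<and> \<Union>F \<subseteq> N}"
    using rsubmodule_carrier rsubmodule_subset[OF assms] by blast
  then show ?thesis unfolding rmod_sum_def by (intro rsubmodule_Inter) blast+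
qed

end

lemma subset_rmod_sum: "N \<in> F \<Longrightarrow> N \<subseteq> rmod_sum R M F"
  unfolding rmod_sum_def by blast

lemma rmod_sum_least: "rsubmodule K R M \<Longrightarrow> (\<And>N. N \<in> F \<Longrightarrow> N \<subseteq> K) \<Longrightarrow> rmod_sum R M F \<subseteq> K"
  unfolding rmod_sum_def by blast

lemma rmod_sum_mono: "F \<subseteq> G \<Longrightarrow> rmod_sum R M F \<subseteq> rmod_sum R M G"
  unfolding rmod_sum_def by blast

context right_module
begin

section \<open>Semisimple modules\<close>

text \<open>Zorn's lemma for submodules. The hypothesis on P speaks of arbitrary nonempty unions,
  which suits both uses: meeting N trivially, and lying in K without containing x.\<close>

lemma maximal_rsubmodule:
  assumes "rsubmodule L R M" "P L"
    and "\<And>C. C \<noteq> {} \<Longrightarrow> (\<And>N. N \<in> C \<Longrightarrow> rsubmodule N R M \<and> P N) \<Longrightarrow> P (\<Union>C)"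
  obtains K where "rsubmodule K R M" "P K"
    "\<And>N. rsubmodule N R M \<Longrightarrow> P N \<Longrightarrow> K \<subseteq> N \<Longrightarrow> N = K"
proof -
  let ?A = "{N. rsubmodule N R M \<and> P N}"
  have "\<exists>K\<in>?A. \<forall>N\<in>?A. K \<subseteq> N \<longrightarrow> N = K"
  proof (rule subset_Zorn_nonempty)
    show "?A \<noteq> {}" using assms by blast
    fix C assume "C \<noteq> {}" "subset.chain ?A C"
    moreover have "rsubmodule (\<Union>C) R M"
      using calculation by (intro rsubmodule_Union_chain) (auto simp: subset_chain_def)
    moreover have "P (\<Union>C)" using calculation assms(3) by (auto simp: subset_chain_def)
    ultimately show "\<Union>C \<in> ?A" by blast
  qed
  then show thesis using that by blast
qed

text \<open>Let K be maximal with N \<inter> K = 0. A simple summand T not inside N + K would meet N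
  + K in 0, and then K + T would still meet N in 0, against maximality. So N + K contains every
  simple summand, hence all of M.\<close>

lemma direct_summand_of_semisimple:
  assumes "semisimple_rmodule R M" and N: "rsubmodule N R M"
  shows "direct_summand R M N"
proof -
  obtain F where F: "is_direct_sum R M F" "\<And>T. T \<in> F \<Longrightarrow> simple_rmodule R (restrict_rmodule M T)"
    using assms unfolding semisimple_rmodule_def by blast
  obtain K where K: "rsubmodule K R M" "N \<inter> K \<subseteq> {\<zero>\<^bsub>M\<^esub>}"
    and max: "\<And>L. rsubmodule L R M \<Longrightarrow> N \<inter> L \<subseteq> {\<zero>\<^bsub>M\<^esub>} \<Longrightarrow> K \<subseteq> L \<Longrightarrow> L = K"
    by (rule maximal_rsubmodule[OF rsubmodule_zero, of "\<lambda>L. N \<inter> L \<subseteq> {\<zero>\<^bsub>M\<^esub>}"]) blast+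
  note NK = rsubmodule_set_add[OF N K(1)]
  have "T \<subseteq> N <+>\<^bsub>M\<^esub> K" if T: "T \<in> F" for T
  proof (rule ccontr)
    assume nsub: "\<not> T \<subseteq> N <+>\<^bsub>M\<^esub> K"
    have Ts: "rsubmodule T R M" using F T unfolding is_direct_sum_def by blast
    then have TNK: "T \<inter> (N <+>\<^bsub>M\<^esub> K) = {\<zero>\<^bsub>M\<^esub>}"
      using F(2)[OF T] rsubmodule_Int[OF Ts NK(1)] nsub unfolding simple_restrict_iff[OF Ts] by blast
    note KT = rsubmodule_set_add[OF K(1) Ts]
    have "N \<inter> (K <+>\<^bsub>M\<^esub> T) \<subseteq> {\<zero>\<^bsub>M\<^esub>}"
    proof
      fix n assume n: "n \<in> N \<inter> (K <+>\<^bsub>M\<^esub> T)"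
      then obtain k t where kt: "k \<in> K" "t \<in> T" "n = k \<oplus>\<^bsub>M\<^esub> t" using mem_set_add by blast
      have c: "n \<in> carrier M" "k \<in> carrier M" "t \<in> carrier M"
        using n kt N K Ts rsubmodule_subset by blast+
      \<comment> \<open>Here t lies in T and, as a difference of elements of N + K, also in N + K;
        so t = 0 and n = k lies in N \<inter> K.\<close>
      have "t = n \<ominus>\<^bsub>M\<^esub> k" using eq_of_add_eq kt c by simp
      then have "t \<in> N <+>\<^bsub>M\<^esub> K" using rsubmodule_diff[OF NK(1)] n kt NK by blast
      then have "t = \<zero>\<^bsub>M\<^esub>" using TNK kt by blast
      then have "n = k" using kt c by simp
      then show "n \<in> {\<zero>\<^bsub>M\<^esub>}" using n kt K by blast
    qed
    then have "K <+>\<^bsub>M\<^esub> T = K" using max KT by blast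
    then show False using KT NK nsub by blast
  qed
  then have "carrier M \<subseteq> N <+>\<^bsub>M\<^esub> K"
    using F(1) rmod_sum_least[OF NK(1), of F] unfolding is_direct_sum_def by blast
  then have "N <+>\<^bsub>M\<^esub> K = carrier M" using rsubmodule_subset[OF NK(1)] by blast
  moreover have "N \<inter> K = {\<zero>\<^bsub>M\<^esub>}" using K N by (auto simp: rsubmodule_iff)
  ultimately show ?thesis unfolding direct_summand_def using N K by blast
qed

text \<open>
  Choose \<open>x \<in> K\<close> nonzero, \<open>L \<le> K\<close> maximal with \<open>x \<notin> L\<close>, and \<open>T\<close> with \<open>K = L \<oplus> T\<close>. If \<open>T = A \<oplus> B\<close>
  with \<open>A\<close> and \<open>B\<close> nonzero, then \<open>x \<in> (L + A) \<inter> (L + B) = L\<close>, a contradiction.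
\<close>

lemma exists_simple_rsubmodule:
  assumes all: "\<And>N. rsubmodule N R M \<Longrightarrow> direct_summand R M N"
    and K: "rsubmodule K R M" "K \<noteq> {\<zero>\<^bsub>M\<^esub>}"
  obtains T where "rsubmodule T R M" "T \<subseteq> K" "simple_rmodule R (restrict_rmodule M T)"
proof -
  obtain x where x: "x \<in> K" "x \<noteq> \<zero>\<^bsub>M\<^esub>" using K by (auto simp: rsubmodule_iff)
  obtain L where L: "rsubmodule L R M" "L \<subseteq> K" "x \<notin> L"
    and max: "\<And>N. rsubmodule N R M \<Longrightarrow> N \<subseteq> K \<and> x \<notin> N \<Longrightarrow> L \<subseteq> N \<Longrightarrow> N = L"
  proof (rule maximal_rsubmodule[OF rsubmodule_zero, of "\<lambda>L. L \<subseteq> K \<and> x \<notin> L"])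
    show "{\<zero>\<^bsub>M\<^esub>} \<subseteq> K \<and> x \<notin> {\<zero>\<^bsub>M\<^esub>}" using K x by (simp add: rsubmodule_iff)
  qed blast+
  obtain L' where L': "rsubmodule L' R M" "L \<inter> L' = {\<zero>\<^bsub>M\<^esub>}" "L <+>\<^bsub>M\<^esub> L' = carrier M"
    using all[OF L(1)] unfolding direct_summand_def by blast
  \<comment> \<open>A complement of L inside K, cut out of the complement L' in M; the modular law
    gives K = L + T.\<close>
  let ?T = "L' \<inter> K"
  have T: "rsubmodule ?T R M" using rsubmodule_Int K L' by blast
  have "?T \<noteq> {\<zero>\<^bsub>M\<^esub>}"
  proof
    assume "?T = {\<zero>\<^bsub>M\<^esub>}"
    moreover have "x \<in> L <+>\<^bsub>M\<^esub> ?T"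
      using modular_law[OF L(1) L'(1) K(1) L(2) x(1)] L'(3) x(1) rsubmodule_subset[OF K(1)] by blast
    ultimately have "x \<in> L"
      using set_add_subset[OF L(1) subset_refl, of ?T] rsubmodule_zero_mem[OF L(1)] by auto
    then show False using L by blast
  qed
  moreover have "A = {\<zero>\<^bsub>M\<^esub>} \<or> A = ?T" if A: "rsubmodule A R M" "A \<subseteq> ?T" for A
  proof (rule ccontr)
    assume n: "\<not> (A = {\<zero>\<^bsub>M\<^esub>} \<or> A = ?T)"
    obtain A' where A': "rsubmodule A' R M" "A \<inter> A' = {\<zero>\<^bsub>M\<^esub>}" "A <+>\<^bsub>M\<^esub> A' = carrier M"
      using all[OF A(1)] unfolding direct_summand_def by blast
    \<comment> \<open>In the same way a complement of A inside T; were it zero, A would be all of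
      T.\<close>
    let ?B = "A' \<inter> ?T"
    have B: "rsubmodule ?B R M" using rsubmodule_Int A' T by blast
    have B0: "?B \<noteq> {\<zero>\<^bsub>M\<^esub>}"
    proof
      assume B: "?B = {\<zero>\<^bsub>M\<^esub>}"
      have "?T \<subseteq> A"
      proof
        fix t assume t: "t \<in> ?T"
        then have "t \<in> A <+>\<^bsub>M\<^esub> ?B"
          using modular_law[OF A(1) A'(1) T A(2) t] A'(3) rsubmodule_subset[OF T] by blast
        then show "t \<in> A"
          using set_add_subset[OF A(1) subset_refl, of ?B] rsubmodule_zero_mem[OF A(1)] B by auto
      qed
      then show False using A n by blast
    qed
    \<comment> \<open>L + C lies in K and is larger than L because L \<inter> C = 0 and C is
      nonzero; by maximality of L it must contain x.\<close>
    have mem: "x \<in> L <+>\<^bsub>M\<^esub> C" if C: "rsubmodule C R M" "C \<subseteq> ?T" "C \<noteq> {\<zero>\<^bsub>M\<^esub>}" for C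
    proof (rule ccontr)
      assume x: "x \<notin> L <+>\<^bsub>M\<^esub> C"
      note LC = rsubmodule_set_add[OF L(1) C(1)]
      have "L <+>\<^bsub>M\<^esub> C \<subseteq> K" using set_add_subset[OF K(1)] L C by blast
      then have "L <+>\<^bsub>M\<^esub> C = L" using max LC x by blast
      then have "C \<subseteq> {\<zero>\<^bsub>M\<^esub>}" using LC(3) C(2) L' by blast
      then show False using C(3) rsubmodule_zero_mem[OF C(1)] by blast
    qed
    obtain l a where la: "l \<in> L" "a \<in> A" "x = l \<oplus>\<^bsub>M\<^esub> a"
      using mem[OF A] n mem_set_add by blast
    obtain l' b where lb: "l' \<in> L" "b \<in> ?B" "x = l' \<oplus>\<^bsub>M\<^esub> b"
      using mem[OF B Int_lower2 B0] mem_set_add by blast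
    \<comment> \<open>Both decompositions of x are along the direct sum of L and L', so a = b. This
      element lies in A \<inter> A' = 0, which puts x into L.\<close>
    have "a = b"
    proof (rule direct_sum_cancel(2)[OF L(1) L'(1,2) la(1) lb(1)])
      show "a \<in> L'" "b \<in> L'" using la(2) lb(2) A(2) by auto
      show "l \<oplus>\<^bsub>M\<^esub> a = l' \<oplus>\<^bsub>M\<^esub> b" using la(3) lb(3) by simp
    qed
    then have "a = \<zero>\<^bsub>M\<^esub>" using la(2) lb(2) A'(2) by blast
    then have "x = l" using la rsubmodule_subset[OF L(1)] by auto
    then show False using la L by blast
  qed
  ultimately have "simple_rmodule R (restrict_rmodule M ?T)"
    unfolding simple_restrict_iff[OF T] by simp
  then show thesis by (rule that[OF T Int_lower2])
qed

section \<open>Independent families of submodules\<close>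

lemma independent_Union_chain:
  assumes "C \<noteq> {}" and chain: "\<And>F G. F \<in> C \<Longrightarrow> G \<in> C \<Longrightarrow> F \<subseteq> G \<or> G \<subseteq> F"
    and sub: "\<And>F N. F \<in> C \<Longrightarrow> N \<in> F \<Longrightarrow> rsubmodule N R M"
    and ind: "\<And>F N. F \<in> C \<Longrightarrow> N \<in> F \<Longrightarrow> N \<inter> rmod_sum R M (F - {N}) = {\<zero>\<^bsub>M\<^esub>}"
    and N: "N \<in> \<Union>C"
  shows "N \<inter> rmod_sum R M (\<Union>C - {N}) = {\<zero>\<^bsub>M\<^esub>}"
proof -
  \<comment> \<open>The sums of the families F - {N}, for F in C, form a chain. Their union is
    therefore a submodule, and it contains every member of the families in C other than N.\<close>
  let ?U = "\<Union>F\<in>C. rmod_sum R M (F - {N})"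
  have mono: "rmod_sum R M (F - {N}) \<subseteq> rmod_sum R M (G - {N})" if "F \<subseteq> G" for F G
    using that by (intro rmod_sum_mono) blast
  have U: "rsubmodule ?U R M"
  proof (rule rsubmodule_Union_chain)
    show "(\<lambda>F. rmod_sum R M (F - {N})) ` C \<noteq> {}" using assms by blast
    show "rsubmodule K R M" if "K \<in> (\<lambda>F. rmod_sum R M (F - {N})) ` C" for K
      using that sub by (auto intro!: rsubmodule_rmod_sum)
    show "K \<subseteq> L \<or> L \<subseteq> K" if KL: "K \<in> (\<lambda>F. rmod_sum R M (F - {N})) ` C"
      "L \<in> (\<lambda>F. rmod_sum R M (F - {N})) ` C" for K L
    proof -
      obtain F G where "F \<in> C" "G \<in> C" "K = rmod_sum R M (F - {N})" "L = rmod_sum R M (G - {N})"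
        using KL by blast
      then show ?thesis using chain[of F G] mono[of F G] mono[of G F] by meson
    qed
  qed
  have "rmod_sum R M (\<Union>C - {N}) \<subseteq> ?U"
  proof (rule rmod_sum_least[OF U])
    fix K assume "K \<in> \<Union>C - {N}"
    then obtain F where "F \<in> C" "K \<in> F - {N}" by blast
    then show "K \<subseteq> ?U" using subset_rmod_sum[of K "F - {N}"] by blast
  qed
  moreover have "N \<inter> ?U \<subseteq> {\<zero>\<^bsub>M\<^esub>}"
  proof
    fix x assume "x \<in> N \<inter> ?U"
    then obtain F where F: "F \<in> C" "x \<in> N" "x \<in> rmod_sum R M (F - {N})" by blast
    obtain G where G: "G \<in> C" "N \<in> G" using N by blast
    \<comment> \<open>F may omit N. If F lies in the member G that contains N, the sum is enlarged
      and independence of G applies; otherwise G \<subseteq> F, so N belongs to F.\<close>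
    consider "F \<subseteq> G" | "N \<in> F" using chain[OF F(1) G(1)] G by blast
    then show "x \<in> {\<zero>\<^bsub>M\<^esub>}"
    proof cases
      case 1 then show ?thesis using F G ind mono by blast
    next
      case 2 then show ?thesis using F ind by blast
    qed
  qed
  moreover have "\<zero>\<^bsub>M\<^esub> \<in> N \<inter> rmod_sum R M (\<Union>C - {N})"
    using N sub by (blast intro: rsubmodule_zero_mem rsubmodule_rmod_sum)
  ultimately show ?thesis by blast
qed

text \<open>For N in F, let n in N equal s + t with s in the sum of the other members of F and t in
  T. Then t = n - s lies in T and in the sum of F, so t = 0, and n = s vanishes by independence of
  F.\<close>

lemma independent_insert:
  assumes sub: "\<And>N. N \<in> F \<Longrightarrow> rsubmodule N R M"
    and ind: "\<And>N. N \<in> F \<Longrightarrow> N \<inter> rmod_sum R M (F - {N}) = {\<zero>\<^bsub>M\<^esub>}"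
    and T: "rsubmodule T R M" "T \<inter> rmod_sum R M F = {\<zero>\<^bsub>M\<^esub>}" "T \<notin> F"
    and N: "N \<in> insert T F"
  shows "N \<inter> rmod_sum R M (insert T F - {N}) = {\<zero>\<^bsub>M\<^esub>}"
proof (cases "N = T")
  case True
  then show ?thesis using T by simp
next
  case False
  then have NF: "N \<in> F" using N by blast
  let ?S = "rmod_sum R M (F - {N})"
  have S: "rsubmodule ?S R M" using sub by (intro rsubmodule_rmod_sum) auto
  have P: "rsubmodule (rmod_sum R M F) R M" using sub by (rule rsubmodule_rmod_sum)
  have SP: "?S \<subseteq> rmod_sum R M F" by (rule rmod_sum_mono) blast
  note ST = rsubmodule_set_add[OF S T(1)]
  have "rmod_sum R M (insert T F - {N}) \<subseteq> ?S <+>\<^bsub>M\<^esub> T"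
  proof (rule rmod_sum_least[OF ST(1)])
    fix K assume "K \<in> insert T F - {N}"
    then show "K \<subseteq> ?S <+>\<^bsub>M\<^esub> T" using ST subset_rmod_sum[of K "F - {N}"] by blast
  qed
  moreover have "N \<inter> (?S <+>\<^bsub>M\<^esub> T) \<subseteq> {\<zero>\<^bsub>M\<^esub>}"
  proof
    fix n assume n: "n \<in> N \<inter> (?S <+>\<^bsub>M\<^esub> T)"
    then obtain s t where st: "s \<in> ?S" "t \<in> T" "n = s \<oplus>\<^bsub>M\<^esub> t" using mem_set_add by blast
    have c: "n \<in> carrier M" "s \<in> carrier M" "t \<in> carrier M"
      using n st sub[OF NF] S T rsubmodule_subset by blast+
    have "t = n \<ominus>\<^bsub>M\<^esub> s" using eq_of_add_eq st c by simp
    moreover have "n \<in> rmod_sum R M F" using n NF subset_rmod_sum by blast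
    ultimately have "t \<in> rmod_sum R M F" using rsubmodule_diff[OF P] SP st by blast
    then have "t = \<zero>\<^bsub>M\<^esub>" using T st by blast
    then have "n = s" using st c by simp
    then show "n \<in> {\<zero>\<^bsub>M\<^esub>}" using n st ind[OF NF] by blast
  qed
  moreover have "\<zero>\<^bsub>M\<^esub> \<in> N \<inter> rmod_sum R M (insert T F - {N})"
    using NF T sub by (blast intro: rsubmodule_zero_mem rsubmodule_rmod_sum)
  ultimately show ?thesis by blast
qed

text \<open>Zorn's lemma gives a maximal independent family F of simple submodules. A nonzero
  complement of its sum would contain a simple T that could be added to F.\<close>

lemma semisimple_of_direct_summands:
  assumes all: "\<And>N. rsubmodule N R M \<Longrightarrow> direct_summand R M N"
  shows "semisimple_rmodule R M"
proof -
  let ?I = "{F. (\<forall>N\<in>F. rsubmodule N R M \<and> simple_rmodule R (restrict_rmodule M N) \<and>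
    N \<inter> rmod_sum R M (F - {N}) = {\<zero>\<^bsub>M\<^esub>})}"
  have "\<exists>F\<in>?I. \<forall>G\<in>?I. F \<subseteq> G \<longrightarrow> G = F"
  proof (rule subset_Zorn_nonempty)
    show "?I \<noteq> {}" by blast
    fix C assume C: "C \<noteq> {}" "subset.chain ?I C"
    then have "N \<inter> rmod_sum R M (\<Union>C - {N}) = {\<zero>\<^bsub>M\<^esub>}" if "N \<in> \<Union>C" for N
      using that by (intro independent_Union_chain) (auto simp: subset_chain_def subset_iff)
    then show "\<Union>C \<in> ?I" using C by (auto simp: subset_chain_def subset_iff)
  qed
  then obtain F where F: "F \<in> ?I" and "\<forall>G\<in>?I. F \<subseteq> G \<longrightarrow> G = F" by (rule bexE)
  then have max: "G = F" if "G \<in> ?I" "F \<subseteq> G" for G using that by (simp only: Ball_def)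
  let ?P = "rmod_sum R M F"
  have P: "rsubmodule ?P R M" using F by (intro rsubmodule_rmod_sum) blast
  obtain K where K: "rsubmodule K R M" "?P \<inter> K = {\<zero>\<^bsub>M\<^esub>}" "?P <+>\<^bsub>M\<^esub> K = carrier M"
    using all[OF P] unfolding direct_summand_def by blast
  have "K = {\<zero>\<^bsub>M\<^esub>}"
  proof (rule ccontr)
    assume "K \<noteq> {\<zero>\<^bsub>M\<^esub>}"
    then obtain T where T: "rsubmodule T R M" "T \<subseteq> K" "simple_rmodule R (restrict_rmodule M T)"
      using exists_simple_rsubmodule[OF all K(1)] by blast
    have TP: "T \<inter> ?P = {\<zero>\<^bsub>M\<^esub>}" using T P K by (auto simp: rsubmodule_iff)
    \<comment> \<open>If T belonged to F it would lie in ?P, and T \<inter> ?P would be T instead of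
      0.\<close>
    have "T \<noteq> {\<zero>\<^bsub>M\<^esub>}" using T simple_restrict_iff by blast
    then have TF: "T \<notin> F" using TP subset_rmod_sum[of T F R M] by blast
    have "N \<inter> rmod_sum R M (insert T F - {N}) = {\<zero>\<^bsub>M\<^esub>}" if "N \<in> insert T F" for N
      using F T TP TF that by (intro independent_insert) auto
    then have "insert T F \<in> ?I" using F T by blast
    then show False using max[of "insert T F"] TF by blast
  qed
  then have "carrier M \<subseteq> ?P"
    using K(3) set_add_subset[OF P subset_refl, of K] rsubmodule_zero_mem[OF P] by auto
  then have "?P = carrier M" using rsubmodule_subset[OF P] by blast
  then show ?thesis unfolding semisimple_rmodule_def is_direct_sum_def using F by blast
qed

section \<open>Homomorphisms and projections\<close>

lemma rmod_homD:
  assumes "f \<in> rmod_hom R M M"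
  shows "x \<in> carrier M \<Longrightarrow> f x \<in> carrier M"
    and "x \<in> carrier M \<Longrightarrow> y \<in> carrier M \<Longrightarrow> f (x \<oplus>\<^bsub>M\<^esub> y) = f x \<oplus>\<^bsub>M\<^esub> f y"
    and "x \<in> carrier M \<Longrightarrow> a \<in> carrier R \<Longrightarrow> f (x \<cdot>\<^bsub>M\<^esub> a) = f x \<cdot>\<^bsub>M\<^esub> a"
    and "f \<in> extensional (carrier M)"
  using assms by (auto simp: rmod_hom_def PiE_def)

lemma rmod_hom_zero:
  assumes "f \<in> rmod_hom R M M" shows "f \<zero>\<^bsub>M\<^esub> = \<zero>\<^bsub>M\<^esub>"
  using rmod_homD(2)[OF assms, of "\<zero>\<^bsub>M\<^esub>" "\<zero>\<^bsub>M\<^esub>"] rmod_homD(1)[OF assms] by simp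

lemma rmod_hom_minus:
  assumes "f \<in> rmod_hom R M M" "x \<in> carrier M" shows "f (\<ominus>\<^bsub>M\<^esub> x) = \<ominus>\<^bsub>M\<^esub> f x"
proof -
  have "f (\<ominus>\<^bsub>M\<^esub> x) \<oplus>\<^bsub>M\<^esub> f x = \<zero>\<^bsub>M\<^esub>"
    using rmod_homD(2)[OF assms(1), of "\<ominus>\<^bsub>M\<^esub> x" x] assms by (simp add: M.l_neg rmod_hom_zero)
  then show ?thesis using rmod_homD(1)[OF assms(1)] assms(2) by (simp add: M.minus_equality)
qed

lemma zero_hom_mem: "zero_hom M M \<in> rmod_hom R M M"
  by (auto simp: zero_hom_def rmod_hom_def zero_rsmult)

lemma rsubmodule_kernel:
  assumes "f \<in> rmod_hom R M M" shows "rsubmodule (a_kernel M M f) R M"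
  using rmod_homD[OF assms] rmod_hom_zero[OF assms]
  by (auto simp: a_kernel_def' rsubmodule_iff zero_rsmult)

lemma rmod_hom_restrict_iff:
  assumes "rsubmodule N R M"
  shows "f \<in> rmod_hom R M (restrict_rmodule M N) \<longleftrightarrow>
    f \<in> rmod_hom R M M \<and> (\<forall>x\<in>carrier M. f x \<in> N)"
  using rsubmodule_subset[OF assms] by (auto simp: rmod_hom_def PiE_def Pi_def)

section \<open>Homomorphisms out of a quotient, and projections\<close>

lemma carrier_quot: "carrier (quot_rmodule M N) = (\<lambda>x. N +>\<^bsub>M\<^esub> x) ` carrier M"
  by (auto simp: quot_rmodule_def A_RCOSETS_def')

lemma quot_add:
  assumes "rsubmodule N R M" "x \<in> carrier M" "y \<in> carrier M"
  shows "(N +>\<^bsub>M\<^esub> x) \<oplus>\<^bsub>quot_rmodule M N\<^esub> (N +>\<^bsub>M\<^esub> y) = N +>\<^bsub>M\<^esub> (x \<oplus>\<^bsub>M\<^esub> y)"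
proof -
  interpret N: rsubmodule N R M by fact
  interpret abelian_subgroup N M
    by (rule abelian_subgroupI3[OF N.additive_subgroup_axioms M.abelian_group_axioms])
  show ?thesis using assms by (simp add: quot_rmodule_def a_rcos_sum)
qed

lemma coset_add:
  assumes "rsubmodule N R M" "n \<in> N" "x \<in> carrier M"
  shows "N +>\<^bsub>M\<^esub> (n \<oplus>\<^bsub>M\<^esub> x) = N +>\<^bsub>M\<^esub> x"
proof -
  interpret N: rsubmodule N R M by fact
  have "n \<oplus>\<^bsub>M\<^esub> x \<in> N +>\<^bsub>M\<^esub> x" using assms by (auto simp: a_r_coset_def')
  then show ?thesis using M.a_repr_independence[OF _ assms(3) N.a_subgroup] by simp
qed

text \<open>Composition with the quotient map turns maps out of M/N into endomorphisms of M that
  vanish on N, to which the Baer condition can be applied.\<close>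

lemma rmod_hom_quot_comp:
  assumes N: "rsubmodule N R M" and h: "h \<in> rmod_hom R (quot_rmodule M N) M"
  defines "f \<equiv> \<lambda>x\<in>carrier M. h (N +>\<^bsub>M\<^esub> x)"
  shows "f \<in> rmod_hom R M M" "n \<in> N \<Longrightarrow> f n = \<zero>\<^bsub>M\<^esub>"
proof -
  have mem: "N +>\<^bsub>M\<^esub> x \<in> carrier (quot_rmodule M N)" if "x \<in> carrier M" for x
    using that by (simp add: carrier_quot)
  have hm: "h X \<in> carrier M" if "X \<in> carrier (quot_rmodule M N)" for X
    using h that by (auto simp: rmod_hom_def)
  have add: "h (N +>\<^bsub>M\<^esub> (x \<oplus>\<^bsub>M\<^esub> y)) = h (N +>\<^bsub>M\<^esub> x) \<oplus>\<^bsub>M\<^esub> h (N +>\<^bsub>M\<^esub> y)"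
    if "x \<in> carrier M" "y \<in> carrier M" for x y
    using h mem[OF that(1)] mem[OF that(2)] by (simp add: rmod_hom_def flip: quot_add[OF N that])
  have smult: "h (N +>\<^bsub>M\<^esub> (x \<cdot>\<^bsub>M\<^esub> a)) = h (N +>\<^bsub>M\<^esub> x) \<cdot>\<^bsub>M\<^esub> a"
    if "x \<in> carrier M" "a \<in> carrier R" for x a
    using h mem[OF that(1)] that(2) by (simp add: rmod_hom_def flip: quot_rsmult[OF N that])
  show f: "f \<in> rmod_hom R M M"
    unfolding f_def using mem hm add smult by (simp add: rmod_hom_def)
  assume n: "n \<in> N"
  then have "n \<in> carrier M" using N rsubmodule_subset by blast
  then have "f n = f \<zero>\<^bsub>M\<^esub>" using coset_add[OF N n, of "\<zero>\<^bsub>M\<^esub>"] by (simp add: f_def)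
  then show "f n = \<zero>\<^bsub>M\<^esub>" using rmod_hom_zero[OF f] by simp
qed

text \<open>A coset of \<open>N\<close> is sent to its unique element in the complement \<open>K\<close>.\<close>

lemma exists_quot_section:
  assumes N: "rsubmodule N R M" and K: "rsubmodule K R M" and NK: "N \<inter> K = {\<zero>\<^bsub>M\<^esub>}"
    and sum: "N <+>\<^bsub>M\<^esub> K = carrier M"
  obtains h where "h \<in> rmod_hom R (quot_rmodule M N) M" "\<And>k. k \<in> K \<Longrightarrow> h (N +>\<^bsub>M\<^esub> k) = k"
proof -
  let ?Q = "quot_rmodule M N"
  define h where "h = (\<lambda>X\<in>carrier ?Q. THE k. k \<in> K \<inter> X)"
  have Kc: "k \<in> carrier M" if "k \<in> K" for k using K that rsubmodule_subset by blast
  have N0: "\<zero>\<^bsub>M\<^esub> \<in> N" using N by (simp add: rsubmodule_iff)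
  have hk: "h (N +>\<^bsub>M\<^esub> k) = k" if k: "k \<in> K" for k
  proof -
    \<comment> \<open>The coset N + k meets K only in k, because N \<inter> K = 0; this justifies
      the \<open>THE\<close> in h.\<close>
    have "k' \<in> K \<inter> (N +>\<^bsub>M\<^esub> k) \<longleftrightarrow> k' = k" for k'
    proof
      assume "k' \<in> K \<inter> (N +>\<^bsub>M\<^esub> k)"
      then obtain n where "n \<in> N" "k' = n \<oplus>\<^bsub>M\<^esub> k" "k' \<in> K" by (auto simp: a_r_coset_def')
      then show "k' = k" using direct_sum_cancel(2)[OF N K NK N0, of n k' k] k Kc by simp
    next
      assume "k' = k"
      moreover have "k \<in> N +>\<^bsub>M\<^esub> k"
        unfolding a_r_coset_def' using N0 k Kc by (auto intro!: bexI[of _ "\<zero>\<^bsub>M\<^esub>"])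
      ultimately show "k' \<in> K \<inter> (N +>\<^bsub>M\<^esub> k)" using k by blast
    qed
    then show ?thesis using k Kc by (simp add: h_def carrier_quot)
  qed
  \<comment> \<open>Since N + K = M, every coset has a representative in K, and the homomorphism
    laws can be checked on these representatives.\<close>
  have rep: "\<exists>k\<in>K. X = N +>\<^bsub>M\<^esub> k" if X: "X \<in> carrier ?Q" for X
  proof -
    obtain x where x: "x \<in> carrier M" "X = N +>\<^bsub>M\<^esub> x" using X by (auto simp: carrier_quot)
    then obtain n k where "n \<in> N" "k \<in> K" "x = n \<oplus>\<^bsub>M\<^esub> k" using sum mem_set_add by blast
    then show ?thesis using coset_add[OF N] x Kc by auto
  qed
  have "h \<in> rmod_hom R ?Q M"
    unfolding rmod_hom_def
  proof (intro CollectI conjI ballI)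
    have "h X \<in> carrier M" if "X \<in> carrier ?Q" for X using rep[OF that] hk Kc by auto
    moreover have "h \<in> extensional (carrier ?Q)" by (simp add: h_def)
    ultimately show "h \<in> carrier ?Q \<rightarrow>\<^sub>E carrier M" by (simp add: PiE_def)
    fix X assume X: "X \<in> carrier ?Q"
    then obtain k where k: "k \<in> K" "X = N +>\<^bsub>M\<^esub> k" using rep by blast
    show "h (X \<oplus>\<^bsub>?Q\<^esub> Y) = h X \<oplus>\<^bsub>M\<^esub> h Y" if Y: "Y \<in> carrier ?Q" for Y
    proof -
      obtain k' where "k' \<in> K" "Y = N +>\<^bsub>M\<^esub> k'" using rep[OF Y] by blast
      moreover have "k \<oplus>\<^bsub>M\<^esub> k' \<in> K" using calculation k K by (simp add: rsubmodule_iff)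
      ultimately show ?thesis using k by (simp add: quot_add[OF N Kc Kc] hk)
    qed
    show "h (X \<cdot>\<^bsub>?Q\<^esub> a) = h X \<cdot>\<^bsub>M\<^esub> a" if a: "a \<in> carrier R" for a
    proof -
      have "k \<cdot>\<^bsub>M\<^esub> a \<in> K" using k a K by (simp add: rsubmodule_iff)
      then show ?thesis using k a by (simp add: quot_rsmult[OF N Kc] hk)
    qed
  qed
  then show thesis using that hk by blast
qed

text \<open>The projection along a complement K is the quotient map to M/K followed by the section
  with values in N; so \<open>exists_quot_section\<close> is used with N and K exchanged.\<close>

lemma exists_projection:
  assumes "direct_summand R M N"
  obtains p where "p \<in> rmod_hom R M M" "\<And>x. x \<in> carrier M \<Longrightarrow> p x \<in> N" "\<And>x. x \<in> N \<Longrightarrow> p x = x"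
proof -
  obtain K where N: "rsubmodule N R M" and K: "rsubmodule K R M" and NK: "N \<inter> K = {\<zero>\<^bsub>M\<^esub>}"
    and sum: "N <+>\<^bsub>M\<^esub> K = carrier M"
    using assms unfolding direct_summand_def by blast
  have c: "N \<subseteq> carrier M" "K \<subseteq> carrier M" using N K rsubmodule_subset by auto
  have KN: "K \<inter> N = {\<zero>\<^bsub>M\<^esub>}" using NK by blast
  have sum': "K <+>\<^bsub>M\<^esub> N = carrier M" using sum set_add_commute[OF c] by simp
  obtain h where h: "h \<in> rmod_hom R (quot_rmodule M K) M" "\<And>n. n \<in> N \<Longrightarrow> h (K +>\<^bsub>M\<^esub> n) = n"
    using exists_quot_section[OF K N KN sum'] by blast
  let ?p = "\<lambda>x\<in>carrier M. h (K +>\<^bsub>M\<^esub> x)"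
  show thesis
  proof (rule that)
    show "?p \<in> rmod_hom R M M" using rmod_hom_quot_comp(1)[OF K h(1)] .
    show id: "?p x = x" if "x \<in> N" for x using that h c by auto
    show "?p x \<in> N" if x: "x \<in> carrier M" for x
    proof -
      obtain k n where "k \<in> K" "n \<in> N" "x = k \<oplus>\<^bsub>M\<^esub> n"
        using x sum' mem_set_add by blast
      moreover have "n \<in> carrier M" using calculation c by blast
      ultimately have "?p x = n" using coset_add[OF K, of k n] h x by simp
      then show ?thesis using \<open>n \<in> N\<close> by simp
    qed
  qed
qed

section \<open>Baer, dual Baer, retractable and co-retractable modules\<close>

lemma Baer_of_direct_summands:
  assumes all: "\<And>N. rsubmodule N R M \<Longrightarrow> direct_summand R M N"
  shows "Baer R M"
  unfolding Baer_def
proof (intro allI impI)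
  fix X assume "X \<subseteq> carrier (End_ring R M)" "X \<noteq> {}"
  then show "direct_summand R M (\<Inter>f\<in>X. a_kernel M M f)"
    using rsubmodule_kernel by (intro all rsubmodule_Inter) (auto simp: End_ring_def)
qed

text \<open>For N different from M a complement K is nonzero, and the section from M/N to K is a
  nonzero map.\<close>

lemma co_retractable_of_direct_summands:
  assumes all: "\<And>N. rsubmodule N R M \<Longrightarrow> direct_summand R M N"
  shows "co_retractable R M"
  unfolding co_retractable_def
proof (intro allI impI)
  fix N assume "rsubmodule N R M \<and> N \<noteq> carrier M"
  then have N: "rsubmodule N R M" "N \<noteq> carrier M" by auto
  obtain K where K: "rsubmodule K R M" "N \<inter> K = {\<zero>\<^bsub>M\<^esub>}" "N <+>\<^bsub>M\<^esub> K = carrier M"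
    using all[OF N(1)] unfolding direct_summand_def by blast
  obtain h where h: "h \<in> rmod_hom R (quot_rmodule M N) M" "\<And>k. k \<in> K \<Longrightarrow> h (N +>\<^bsub>M\<^esub> k) = k"
    using exists_quot_section[OF N(1) K] by blast
  have "\<not> K \<subseteq> N"
    using set_add_subset[OF N(1) subset_refl, of K] K(3) N(2) rsubmodule_subset[OF N(1)] by blast
  then obtain k where k: "k \<in> K" "k \<noteq> \<zero>\<^bsub>M\<^esub>" using K by blast
  then have "N +>\<^bsub>M\<^esub> k \<in> carrier (quot_rmodule M N)"
    using rsubmodule_subset[OF K(1)] by (auto simp: carrier_quot)
  then have "h \<noteq> zero_hom (quot_rmodule M N) M" using h(2)[OF k(1)] k by (auto simp: zero_hom_def)
  then show "rmod_hom R (quot_rmodule M N) M \<noteq> {zero_hom (quot_rmodule M N) M}" using h by blast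
qed

text \<open>A projection onto N fixes every element of N, so it is nonzero when N is.\<close>

lemma retractable_of_direct_summands:
  assumes all: "\<And>N. rsubmodule N R M \<Longrightarrow> direct_summand R M N"
  shows "retractable R M"
  unfolding retractable_def
proof (intro allI impI)
  fix N assume "rsubmodule N R M \<and> N \<noteq> {\<zero>\<^bsub>M\<^esub>}"
  then have N: "rsubmodule N R M" "N \<noteq> {\<zero>\<^bsub>M\<^esub>}" by auto
  obtain p where p: "p \<in> rmod_hom R M M" "\<And>x. x \<in> carrier M \<Longrightarrow> p x \<in> N" "\<And>x. x \<in> N \<Longrightarrow> p x = x"
    using exists_projection[OF all[OF N(1)]] by blast
  obtain n where "n \<in> N" "n \<noteq> \<zero>\<^bsub>M\<^esub>" "n \<in> carrier M" using N by (auto simp: rsubmodule_iff)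
  then have "p \<noteq> zero_hom M (restrict_rmodule M N)" using p(3)[of n] by (auto simp: zero_hom_def)
  moreover have "p \<in> rmod_hom R M (restrict_rmodule M N)"
    using p rmod_hom_restrict_iff[OF N(1)] by blast
  ultimately show "rmod_hom R M (restrict_rmodule M N) \<noteq> {zero_hom M (restrict_rmodule M N)}"
    by blast
qed

text \<open>The idempotent is a projection p onto N: an endomorphism f has its image in N exactly
  when p f = f.\<close>

lemma dual_Baer_of_direct_summands:
  assumes all: "\<And>N. rsubmodule N R M \<Longrightarrow> direct_summand R M N"
  shows "dual_Baer R M"
  unfolding dual_Baer_def Let_def
proof (intro allI impI)
  let ?S = "End_ring R M"
  interpret S: ring ?S by (rule ring_End_ring)
  fix N assume N: "rsubmodule N R M"
  obtain p where p: "p \<in> rmod_hom R M M" "\<And>x. x \<in> carrier M \<Longrightarrow> p x \<in> N" "\<And>x. x \<in> N \<Longrightarrow> p x = x"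
    using exists_projection[OF all[OF N]] by blast
  have pS: "p \<in> carrier ?S" using p by (simp add: End_ring_def)
  have absorb: "p \<otimes>\<^bsub>?S\<^esub> f = f" if "f \<in> rmod_hom R M M" "\<And>x. x \<in> carrier M \<Longrightarrow> f x \<in> N" for f
    using that p rmod_homD(4)[of f]
    by (intro extensionalityI[of _ "carrier M"]) (auto simp: End_ring_def compose_def)
  have "rmod_hom R M (restrict_rmodule M N) = p <#\<^bsub>?S\<^esub> carrier ?S"
  proof (intro equalityI subsetI)
    fix f assume "f \<in> rmod_hom R M (restrict_rmodule M N)"
    then have f: "f \<in> rmod_hom R M M" "\<And>x. x \<in> carrier M \<Longrightarrow> f x \<in> N"
      using rmod_hom_restrict_iff[OF N] by auto
    then have "f = p \<otimes>\<^bsub>?S\<^esub> f" "f \<in> carrier ?S" using absorb by (auto simp: End_ring_def)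
    then show "f \<in> p <#\<^bsub>?S\<^esub> carrier ?S" unfolding l_coset_def by blast
  next
    fix f assume "f \<in> p <#\<^bsub>?S\<^esub> carrier ?S"
    then obtain g where g: "g \<in> carrier ?S" "f = p \<otimes>\<^bsub>?S\<^esub> g" unfolding l_coset_def by blast
    have "f \<in> carrier ?S" using g pS by simp
    moreover have "f x \<in> N" if "x \<in> carrier M" for x
      using g p(2) that rmod_homD(1)[of g] by (auto simp: End_ring_def compose_def)
    ultimately show "f \<in> rmod_hom R M (restrict_rmodule M N)"
      using rmod_hom_restrict_iff[OF N] by (simp add: End_ring_def)
  qed
  then show "\<exists>e\<in>carrier ?S. e \<otimes>\<^bsub>?S\<^esub> e = e \<and>
      rmod_hom R M (restrict_rmodule M N) = e <#\<^bsub>?S\<^esub> carrier ?S"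
    using pS absorb[OF p(1,2)] by blast
qed

section \<open>From the pairs of properties back to splitting submodules\<close>

lemma direct_summand_of_co_retractable_Baer:
  assumes co: "co_retractable R M" and Baer: "Baer R M" and N: "rsubmodule N R M"
  shows "direct_summand R M N"
proof -
  let ?X = "{f \<in> rmod_hom R M M. \<forall>n\<in>N. f n = \<zero>\<^bsub>M\<^esub>}"
  let ?I = "\<Inter>f\<in>?X. a_kernel M M f"
  have Nc: "N \<subseteq> carrier M" using rsubmodule_subset[OF N] .
  \<comment> \<open>The zero map makes ?X nonempty, as the Baer condition requires.\<close>
  have "zero_hom M M \<in> ?X" using zero_hom_mem Nc by (auto simp: zero_hom_def)
  moreover have "?X \<subseteq> carrier (End_ring R M)" by (auto simp: End_ring_def)
  ultimately have I: "direct_summand R M ?I" using Baer unfolding Baer_def by blast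
  then obtain K where K: "rsubmodule K R M" "?I \<inter> K = {\<zero>\<^bsub>M\<^esub>}" "?I <+>\<^bsub>M\<^esub> K = carrier M"
    and Is: "rsubmodule ?I R M"
    unfolding direct_summand_def by blast
  have NI: "N \<subseteq> ?I" using Nc by (auto simp: a_kernel_def')
  note NK = rsubmodule_set_add[OF N K(1)]
  have "N <+>\<^bsub>M\<^esub> K = carrier M"
  proof (rule ccontr)
    let ?Q = "quot_rmodule M (N <+>\<^bsub>M\<^esub> K)"
    assume "N <+>\<^bsub>M\<^esub> K \<noteq> carrier M"
    then have "rmod_hom R ?Q M \<noteq> {zero_hom ?Q M}" using co NK unfolding co_retractable_def by blast
    moreover have "h = zero_hom ?Q M" if h: "h \<in> rmod_hom R ?Q M" for h
    proof -
      \<comment> \<open>The pullback of h to M. It vanishes on N, so it belongs to ?X and vanishes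
        on ?I; it also vanishes on K, hence on ?I + K = M.\<close>
      let ?f = "\<lambda>x\<in>carrier M. h ((N <+>\<^bsub>M\<^esub> K) +>\<^bsub>M\<^esub> x)"
      note f = rmod_hom_quot_comp[OF NK(1) h]
      have "?f \<in> ?X" using f NK by blast
      then have "?I \<subseteq> a_kernel M M ?f" by blast
      moreover have "K \<subseteq> a_kernel M M ?f"
      proof
        fix k assume "k \<in> K"
        then show "k \<in> a_kernel M M ?f"
          using f(2)[of k] NK(3) rsubmodule_subset[OF K(1)] unfolding a_kernel_def' by blast
      qed
      ultimately have "?I <+>\<^bsub>M\<^esub> K \<subseteq> a_kernel M M ?f"
        by (rule set_add_subset[OF rsubmodule_kernel[OF f(1)]])
      then have "carrier M \<subseteq> a_kernel M M ?f" by (simp only: K(3))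
      then have "?f x = \<zero>\<^bsub>M\<^esub>" if "x \<in> carrier M" for x
        using that unfolding a_kernel_def' by blast
      then have "h X = \<zero>\<^bsub>M\<^esub>" if "X \<in> carrier ?Q" for X
        using that by (auto simp: carrier_quot)
      moreover have "h \<in> extensional (carrier ?Q)" using h by (auto simp: rmod_hom_def PiE_def)
      ultimately show ?thesis
        by (intro extensionalityI[of _ "carrier ?Q"]) (auto simp: zero_hom_def)
    qed
    \<comment> \<open>Co-retractability says that the set of homomorphisms is not {0}; an empty set
      would satisfy this too, so the zero map has to be exhibited as a member.\<close>
    moreover have "zero_hom ?Q M \<in> rmod_hom R ?Q M"
    proof -
      interpret Q: right_module R ?Q using quot_right_module[OF NK(1)] .
      show ?thesis by (auto simp: zero_hom_def rmod_hom_def zero_rsmult)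
    qed
    ultimately show False by blast
  qed
  moreover have "N \<inter> K = {\<zero>\<^bsub>M\<^esub>}" using NI K(1,2) N by (auto simp: rsubmodule_iff)
  ultimately show ?thesis unfolding direct_summand_def using N K(1) by blast
qed

lemma direct_summand_of_retractable_dual_Baer:
  assumes re: "retractable R M" and dB: "dual_Baer R M" and N: "rsubmodule N R M"
  shows "direct_summand R M N"
proof -
  let ?S = "End_ring R M"
  obtain e where e: "e \<in> carrier ?S" "e \<otimes>\<^bsub>?S\<^esub> e = e"
    and hom: "rmod_hom R M (restrict_rmodule M N) = e <#\<^bsub>?S\<^esub> carrier ?S"
    using dB N unfolding dual_Baer_def Let_def by blast
  have eh: "e \<in> rmod_hom R M M" using e by (simp add: End_ring_def)
  note e_hom = rmod_homD[OF eh]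
  have ee: "e (e x) = e x" if "x \<in> carrier M" for x
    using fun_cong[OF e(2), of x] that by (simp add: End_ring_def compose_def)
  \<comment> \<open>From e = e e the map e itself lies in eS = Hom(M, N), so its image is inside
    N.\<close>
  have "e \<in> e <#\<^bsub>?S\<^esub> carrier ?S" using e unfolding l_coset_def by blast
  then have eN: "e x \<in> N" if "x \<in> carrier M" for x
    using that hom rmod_hom_restrict_iff[OF N] by blast
  let ?K = "a_kernel M M e" \<comment> \<open>equal to \<open>(1 - e)M\<close>\<close>
  have K: "rsubmodule ?K R M" using rsubmodule_kernel[OF eh] .
  have NK: "rsubmodule (N \<inter> ?K) R M" using rsubmodule_Int N K by blast
  have "N \<inter> ?K = {\<zero>\<^bsub>M\<^esub>}"
  proof (rule ccontr)
    let ?L = "restrict_rmodule M (N \<inter> ?K)"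
    assume "N \<inter> ?K \<noteq> {\<zero>\<^bsub>M\<^esub>}"
    then have "rmod_hom R M ?L \<noteq> {zero_hom M ?L}" using re NK unfolding retractable_def by blast
    moreover have "f = zero_hom M ?L" if "f \<in> rmod_hom R M ?L" for f
    proof -
      have f: "f \<in> rmod_hom R M M" "\<And>x. x \<in> carrier M \<Longrightarrow> f x \<in> N \<and> f x \<in> ?K"
        using that rmod_hom_restrict_iff[OF NK] by auto
      \<comment> \<open>Since f also maps into N, it has the form e g, so e f = e e g = f; but f
        takes values in the kernel of e.\<close>
      then have "f \<in> e <#\<^bsub>?S\<^esub> carrier ?S" using rmod_hom_restrict_iff[OF N] hom by blast
      then obtain g where g: "g \<in> carrier ?S" "f = e \<otimes>\<^bsub>?S\<^esub> g" unfolding l_coset_def by blast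
      have "f x = \<zero>\<^bsub>M\<^esub>" if x: "x \<in> carrier M" for x
      proof -
        have "g x \<in> carrier M" using g x rmod_homD(1)[of g] by (simp add: End_ring_def)
        then have "e (f x) = f x" using g x ee by (simp add: End_ring_def compose_def)
        then show ?thesis using f(2)[OF x] by (simp add: a_kernel_def')
      qed
      then show ?thesis using rmod_homD(4)[OF f(1)]
        by (intro extensionalityI[of _ "carrier M"]) (auto simp: zero_hom_def)
    qed
    \<comment> \<open>Excludes an empty set of homomorphisms, which would also differ from
      {0}.\<close>
    moreover have "zero_hom M ?L \<in> rmod_hom R M ?L"
      using NK zero_hom_mem
      by (auto simp: rmod_hom_restrict_iff[OF NK] zero_hom_def rsubmodule_iff)
    ultimately show False by blast
  qed
  moreover have "N <+>\<^bsub>M\<^esub> ?K = carrier M"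
  proof
    show "N <+>\<^bsub>M\<^esub> ?K \<subseteq> carrier M" using rsubmodule_subset rsubmodule_set_add(1)[OF N K] .
    show "carrier M \<subseteq> N <+>\<^bsub>M\<^esub> ?K"
    proof
      fix x assume x: "x \<in> carrier M"
      \<comment> \<open>Every x splits as e x + (x - e x), where e kills the second summand by
        idempotence.\<close>
      have "e (x \<ominus>\<^bsub>M\<^esub> e x) = \<zero>\<^bsub>M\<^esub>"
        using x e_hom(1) by (simp add: a_minus_def e_hom(2) rmod_hom_minus[OF eh] ee M.r_neg)
      then have "x \<ominus>\<^bsub>M\<^esub> e x \<in> ?K" using x e_hom(1) by (simp add: a_kernel_def')
      moreover have "x = e x \<oplus>\<^bsub>M\<^esub> (x \<ominus>\<^bsub>M\<^esub> e x)"
        using x e_hom(1)[OF x] by (simp add: a_minus_def M.a_ac M.r_neg M.r_neg1 M.r_neg2)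
      ultimately show "x \<in> N <+>\<^bsub>M\<^esub> ?K" using eN[OF x] unfolding mem_set_add by blast
    qed
  qed
  ultimately show ?thesis unfolding direct_summand_def using N K by blast
qed

end

theorem theorem3p2:
  fixes R :: "('a, 'r) ring_scheme" and M :: "('a, 'b, 'm) rmodule_scheme"
  assumes "right_module R M"
  shows "(semisimple_rmodule R M \<longleftrightarrow> co_retractable R M \<and> Baer R M) \<and>
         (semisimple_rmodule R M \<longleftrightarrow> retractable R M \<and> dual_Baer R M)"
proof -
  interpret right_module R M by fact
  show ?thesis
    using direct_summand_of_semisimple semisimple_of_direct_summands
      co_retractable_of_direct_summands Baer_of_direct_summands
      retractable_of_direct_summands dual_Baer_of_direct_summands
      direct_summand_of_co_retractable_Baer direct_summand_of_retractable_dual_Baer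
    by blast
qed

end
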